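(* Let $\mathcal X$ be a Polish space and $\mathcal Y$ a locally compact Polish space. Let $\{\mu_n\}_{n\in\mathbb N}$ be probability measures on $\mathcal X\times\mathcal Y$ such that each $\mu_n$ has a measurable density $f_n$ with respect to $\mu_n^{\mathcal X}\otimes\mu_n^{\mathcal Y}$. Assume (i) $\mu_n\to\mu$ in the weak-* topology, (ii) $\mu$ has a continuous density $f$ with respect to $\mu^{\mathcal X}\otimes\mu^{\mathcal Y}$, and (iii) $f_n\to f$ uniformly on each compact subset of $\mathcal X\times\mathcal Y$. Then $\mu_n\to\mu$ in $\wp_I(\mathcal X\times\mathcal Y)$.
   Context: For a Polish space $\mathcal S$, $\wp(\mathcal S)$ denotes the Borel probability measures and $\wp_w(\mathcal S)$ this set with the weak-* topology (weakest topology making $\mu\mapsto\int g\,d\mu$ continuous for all bounded continuous $g$). For $\mu\in\wp(\mathcal X\times\mathcal Y)$, $\mu^{\mathcal X},\mu^{\mathcal Y}$ are the marginals and $\mu(\cdot\mid x)$ a regular conditional distribution on $\mathcal Y$ given $x$. Let $\psi(\mu)\in\wp(\mathcal X\times\wp_w(\mathcal Y))$ be $\psi(\mu)(dx,d\zeta)=\delta_{\mu(\cdot\mid x)}(d\zeta)\mu^{\mathcal X}(dx)$. The topology of information on $\wp(\mathcal X\times\mathcal Y)$ is the coarsest topology making $\psi$ continuous into $\wp_w(\mathcal X\times\wp_w(\mathcal Y))$; $\wp_I(\mathcal X\times\mathcal Y)$ denotes $\wp(\mathcal X\times\mathcal Y)$ with it. Thus $\mu_n\to\mu$ in $\wp_I(\mathcal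 X\times\mathcal Y)$ iff $\psi(\mu_n)\to\psi(\mu)$ weak-*. *)

theory Defs
  imports "HOL-Probability.Probability"
begin

definition prob_borel :: "'a::topological_space measure set" where
  "prob_borel = {M. prob_space M \<and> sets M = sets borel}"

definition bcont :: "('a::topological_space \<Rightarrow> real) set" where
  "bcont = {g. continuous_on UNIV g \<and> bounded (range g)}"

definition weak_star_conv :: "(nat \<Rightarrow> 'a::topological_space measure) \<Rightarrow> 'a measure \<Rightarrow> bool" where
  "weak_star_conv \<mu>s \<mu> \<longleftrightarrow>
     (\<forall>g\<in>bcont. (\<lambda>n. \<integral>z. g z \<partial>\<mu>s n) \<longlonglongrightarrow> (\<integral>z. g z \<partial>\<mu>))"

definition weak_top :: "'b::topological_space measure topology" where
  "weak_top = topology_generated_by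
     {{\<nu> \<in> prob_borel. (\<integral>y. g y \<partial>\<nu>) \<in> U} | g U. g \<in> bcont \<and> open U}"

definition marg1 :: "('a::topological_space \<times> 'b::topological_space) measure \<Rightarrow> 'a measure" where
  "marg1 \<mu> = distr \<mu> borel fst"

definition marg2 :: "('a::topological_space \<times> 'b::topological_space) measure \<Rightarrow> 'b measure" where
  "marg2 \<mu> = distr \<mu> borel snd"

definition rcd :: "('a::topological_space \<times> 'b::topological_space) measure \<Rightarrow> ('a \<Rightarrow> 'b measure) \<Rightarrow> bool" where
  "rcd \<mu> \<kappa> \<longleftrightarrow>
     (\<forall>x. \<kappa> x \<in> prob_borel) \<and>
     (\<forall>B\<in>sets borel. (\<lambda>x. emeasure (\<kappa> x) B) \<in> borel_measurable borel) \<and>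
     (\<forall>A\<in>sets borel. \<forall>B\<in>sets borel.
        emeasure \<mu> (A \<times> B) = (\<integral>\<^sup>+x\<in>A. emeasure (\<kappa> x) B \<partial>marg1 \<mu>))"

text \<open>\<open>\<integral> G d\<psi>(\<mu>)\<close> where \<open>\<psi>(\<mu>)(dx,d\<zeta>) = \<delta>_{\<mu>(\<cdot>|x)}(d\<zeta>) \<mu>^X(dx)\<close>, computed with the
  conditional distribution \<open>\<kappa>\<close>.\<close>
definition psi_integral :: "('a::topological_space \<times> 'b::topological_space) measure \<Rightarrow> ('a \<Rightarrow> 'b measure)
     \<Rightarrow> ('a \<times> 'b measure \<Rightarrow> real) \<Rightarrow> real" where
  "psi_integral \<mu> \<kappa> G = (\<integral>x. G (x, \<kappa> x) \<partial>marg1 \<mu>)"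

definition bcont_psi :: "('a::topological_space \<times> 'b::topological_space measure \<Rightarrow> real) set" where
  "bcont_psi = {G. continuous_map (prod_topology euclidean weak_top) euclideanreal G \<and>
                   bounded (G ` topspace (prod_topology euclidean (weak_top :: 'b measure topology)))}"

text \<open>Convergence in the topology of information: \<open>\<psi>(\<mu>_n) \<rightarrow> \<psi>(\<mu>)\<close> weak-*,
  for any choice of regular conditional distributions.\<close>
definition info_conv :: "(nat \<Rightarrow> ('a::topological_space \<times> 'b::topological_space) measure)
     \<Rightarrow> ('a \<times> 'b) measure \<Rightarrow> bool" where
  "info_conv \<mu>s \<mu> \<longleftrightarrow>
     (\<forall>\<kappa>s \<kappa>. (\<forall>n. rcd (\<mu>s n) (\<kappa>s n)) \<and> rcd \<mu> \<kappa> \<longrightarrow>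
        (\<forall>G\<in>bcont_psi. (\<lambda>n. psi_integral (\<mu>s n) (\<kappa>s n) G) \<longlonglongrightarrow> psi_integral \<mu> \<kappa> G))"

end

theory Submission
  imports Defs
begin

text \<open>Almost surely, \<open>\<mu>_n(dy|x) = f_n(x,y) \<mu>_n^Y(dy)\<close> and \<open>\<mu>(dy|x) = f(x,y) \<mu>^Y(dy)\<close>. If \<open>x_n\<close>
  tends to \<open>x\<close> through points where these identities hold, then locally uniform convergence of the
  densities gives \<open>\<mu>_n(dy|x_n) \<rightarrow> \<mu>(dy|x)\<close> against compactly supported functions, hence weakly,
  because the limit has mass one and \<open>Y\<close> is the union of countably many compact sets. So
  \<open>h_n(x) = G(x, \<mu>_n(dy|x))\<close> satisfies \<open>h_n(x_n) \<rightarrow> h(x)\<close> for almost every \<open>x\<close>, and an extended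
  continuous mapping theorem yields \<open>\<integral>h_n d\<mu>_n^X \<rightarrow> \<integral>h d\<mu>^X\<close>. The latter is proved without
  tightness, by squeezing \<open>h_n\<close> below Lipschitz envelopes of the tails.\<close>

section \<open>Weak convergence\<close>

lemma bcont_bounded:
  assumes "g \<in> bcont"
  obtains C where "C > 0" "\<And>y. \<bar>g y\<bar> \<le> C"
proof -
  from assms have "bounded (range g)" by (simp add: bcont_def)
  then obtain C where "C > 0" "\<forall>x\<in>range g. norm x \<le> C" using bounded_pos by blast
  then show ?thesis using that by auto
qed

lemma bcontI:
  assumes "continuous_on UNIV g" "\<And>y. \<bar>g y\<bar> \<le> (C::real)"
  shows "g \<in> bcont"
  using assms by (auto simp: bcont_def bounded_iff)

lemma bcont_measurable: "g \<in> bcont \<Longrightarrow> g \<in> borel_measurable borel"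
  by (auto simp: bcont_def intro: borel_measurable_continuous_onI)

lemma prob_borel_integrable:
  fixes g :: "'b::topological_space \<Rightarrow> real"
  assumes "\<nu> \<in> prob_borel" "g \<in> borel_measurable borel" "\<And>y. \<bar>g y\<bar> \<le> C"
  shows "integrable \<nu> g"
proof -
  interpret prob_space \<nu> using assms(1) by (simp add: prob_borel_def)
  have [measurable_cong]: "sets \<nu> = sets borel" using assms(1) by (simp add: prob_borel_def)
  have [measurable]: "g \<in> borel_measurable \<nu>"
    using assms(2) by (simp cong: measurable_cong_sets)
  show ?thesis by (rule integrable_const_bound[of _ C]) (use assms in auto)
qed

lemma prob_borel_integral_mono:
  fixes g h :: "'b::topological_space \<Rightarrow> real"
  assumes "\<nu> \<in> prob_borel" "g \<in> borel_measurable borel" "\<And>y. \<bar>g y\<bar> \<le> C"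
    "h \<in> borel_measurable borel" "\<And>y. \<bar>h y\<bar> \<le> D" "\<And>y. g y \<le> h y"
  shows "(\<integral>y. g y \<partial>\<nu>) \<le> (\<integral>y. h y \<partial>\<nu>)"
  using assms by (intro integral_mono prob_borel_integrable) auto

lemma prob_borel_integral_const:
  assumes "\<nu> \<in> prob_borel" shows "(\<integral>y. c \<partial>\<nu>) = (c::real)"
proof -
  interpret prob_space \<nu> using assms(1) by (simp add: prob_borel_def)
  show ?thesis by (simp add: prob_space)
qed

lemma prob_borel_dominated_convergence:
  fixes g :: "'b::topological_space \<Rightarrow> real"
  assumes "\<nu> \<in> prob_borel" "\<And>k. \<phi> k \<in> borel_measurable borel" "g \<in> borel_measurable borel"
    "\<And>k y. \<bar>\<phi> k y\<bar> \<le> C" "AE y in \<nu>. (\<lambda>k. \<phi> k y) \<longlonglongrightarrow> g y"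
  shows "(\<lambda>k. \<integral>y. \<phi> k y \<partial>\<nu>) \<longlonglongrightarrow> (\<integral>y. g y \<partial>\<nu>)"
proof -
  have S: "sets \<nu> = sets borel" using assms(1) by (simp add: prob_borel_def)
  show ?thesis
  proof (rule integral_dominated_convergence[where w="\<lambda>_. C"])
    show "integrable \<nu> (\<lambda>_. C)" by (rule prob_borel_integrable[OF assms(1), of _ "\<bar>C\<bar>"]) auto
  qed (use assms S in \<open>auto cong: measurable_cong_sets\<close>)
qed

text \<open>Approximation from below gives only the lower half of convergence, for nonnegative test
  functions. The upper half comes from reflecting \<open>g\<close>, since adding a constant to a
  test function shifts all the integrals by the same amount when every measure has mass one. The
  minorants \<open>\<phi> k\<close> are only Borel, so step functions are allowed as well as
  compactly supported continuous functions.\<close>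

lemma weak_conv_lower_approx:
  fixes \<nu>s :: "nat \<Rightarrow> 'b::topological_space measure"
  assumes \<nu>s: "\<And>i. \<nu>s i \<in> prob_borel" and \<nu>: "\<nu> \<in> prob_borel"
    and appr: "\<And>g. g \<in> bcont \<Longrightarrow> (\<And>y. 0 \<le> g y) \<Longrightarrow>
      \<exists>\<phi>. \<forall>k. \<phi> k \<in> borel_measurable borel \<and> (\<forall>y. 0 \<le> \<phi> k y \<and> \<phi> k y \<le> g y) \<and>
        (\<forall>y. (\<lambda>k. \<phi> k y) \<longlonglongrightarrow> g y) \<and> (\<lambda>i. \<integral>y. \<phi> k y \<partial>\<nu>s i) \<longlonglongrightarrow> (\<integral>y. \<phi> k y \<partial>\<nu>)"
    and g: "g \<in> bcont"
  shows "(\<lambda>i. \<integral>y. g y \<partial>\<nu>s i) \<longlonglongrightarrow> (\<integral>y. g y \<partial>\<nu>)"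
proof -
  have low: "\<forall>\<^sub>F i in sequentially. (\<integral>y. h y \<partial>\<nu>s i) > (\<integral>y. h y \<partial>\<nu>) - e"
    if h: "h \<in> bcont" and h0: "\<And>y. 0 \<le> h y" and e: "e > 0" for h e
  proof -
    obtain C where C: "\<And>y. \<bar>h y\<bar> \<le> C" using bcont_bounded[OF h] by metis
    obtain \<phi> where \<phi>: "\<And>k. \<phi> k \<in> borel_measurable borel"
        "\<And>k y. 0 \<le> \<phi> k y" "\<And>k y. \<phi> k y \<le> h y" "\<And>y. (\<lambda>k. \<phi> k y) \<longlonglongrightarrow> h y"
        "\<And>k. (\<lambda>i. \<integral>y. \<phi> k y \<partial>\<nu>s i) \<longlonglongrightarrow> (\<integral>y. \<phi> k y \<partial>\<nu>)"
      using appr[OF h h0] by blast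
    have C': "\<bar>\<phi> k y\<bar> \<le> C" for k y using \<phi>(2)[of k y] \<phi>(3)[of k y] C[of y] by linarith
    have "(\<lambda>k. \<integral>y. \<phi> k y \<partial>\<nu>) \<longlonglongrightarrow> (\<integral>y. h y \<partial>\<nu>)"
      by (rule prob_borel_dominated_convergence[OF \<nu>])
        (use \<phi> C' bcont_measurable[OF h] in auto)
    \<comment> \<open>First one \<open>k\<close> is fixed for which the minorant loses less than
      \<open>e\<close> under \<open>\<nu>\<close>; only then does \<open>i\<close> grow.\<close>
    then have "\<forall>\<^sub>F k in sequentially. (\<integral>y. \<phi> k y \<partial>\<nu>) > (\<integral>y. h y \<partial>\<nu>) - e"
      using e by (intro order_tendstoD) auto
    then obtain k where k: "(\<integral>y. \<phi> k y \<partial>\<nu>) > (\<integral>y. h y \<partial>\<nu>) - e"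
      using eventually_happens by fastforce
    have "\<forall>\<^sub>F i in sequentially. (\<integral>y. \<phi> k y \<partial>\<nu>s i) > (\<integral>y. h y \<partial>\<nu>) - e"
      using k by (intro order_tendstoD(1)[OF \<phi>(5)])
    then show ?thesis
    proof eventually_elim
      case (elim i)
      have "(\<integral>y. \<phi> k y \<partial>\<nu>s i) \<le> (\<integral>y. h y \<partial>\<nu>s i)"
        by (rule prob_borel_integral_mono[OF \<nu>s \<phi>(1) C' bcont_measurable[OF h] C \<phi>(3)])
      with elim show ?case by linarith
    qed
  qed
  obtain C where C: "\<And>y. \<bar>g y\<bar> \<le> C" using bcont_bounded[OF g] by metis
  have gc: "continuous_on UNIV g" using g by (simp add: bcont_def)
  have int: "integrable \<mu> g" if "\<mu> \<in> prob_borel" for \<mu>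
    by (rule prob_borel_integrable[OF that bcont_measurable[OF g] C])
  have intc: "integrable \<mu> (\<lambda>_. c)" if "\<mu> \<in> prob_borel" for \<mu> :: "'b measure" and c :: real
    by (rule prob_borel_integrable[OF that, of _ "\<bar>c\<bar>"]) auto
  have bnd: "\<bar>g y + C\<bar> \<le> 2 * C" "\<bar>C - g y\<bar> \<le> 2 * C" "0 \<le> g y + C" "0 \<le> C - g y" for y
    using C[of y] by auto
  \<comment> \<open>These are the two nonnegative test functions to which \<open>low\<close>
    applies: the first bounds the integrals of \<open>g\<close> from below, the second from
    above.\<close>
  have "(\<lambda>y. g y + C) \<in> bcont" "(\<lambda>y. C - g y) \<in> bcont"
    by (rule bcontI[where C="2*C"]; use bnd gc in \<open>auto intro!: continuous_intros\<close>)+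
  note L = low[OF this(1) bnd(3)] low[OF this(2) bnd(4)]
  have I: "(\<integral>y. g y + C \<partial>\<mu>) = (\<integral>y. g y \<partial>\<mu>) + C" "(\<integral>y. C - g y \<partial>\<mu>) = C - (\<integral>y. g y \<partial>\<mu>)"
    if "\<mu> \<in> prob_borel" for \<mu>
    using int[OF that] intc[OF that] prob_borel_integral_const[OF that] by auto
  show ?thesis
  proof (rule tendstoI)
    fix e :: real assume "e > 0"
    from L(1)[OF this] L(2)[OF this]
    show "\<forall>\<^sub>F i in sequentially. dist (\<integral>y. g y \<partial>\<nu>s i) (\<integral>y. g y \<partial>\<nu>) < e"
      by eventually_elim (use \<nu>s \<nu> in \<open>auto simp: I dist_real_def abs_less_iff\<close>)
  qed
qed

section \<open>The weak topology on probability measures and its continuous test functions\<close>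

lemma topspace_weak_top: "topspace (weak_top :: 'b::topological_space measure topology) = prob_borel"
proof -
  have "(\<lambda>_. 0) \<in> (bcont :: ('b \<Rightarrow> real) set)" by (rule bcontI[where C=0]) auto
  moreover have "open (UNIV :: real set)" by simp
  ultimately show ?thesis
    unfolding weak_top_def topology_generated_by_topspace by blast
qed

text \<open>Induction on the generation of open sets: being eventually inside passes from the
  subbasis to finite intersections and arbitrary unions.\<close>

lemma limitin_weak_top:
  assumes \<nu>s: "\<And>i. \<nu>s i \<in> prob_borel" and \<nu>: "\<nu> \<in> prob_borel"
    and conv: "\<And>g. g \<in> bcont \<Longrightarrow> ((\<lambda>i. \<integral>y. g y \<partial>\<nu>s i) \<longlongrightarrow> (\<integral>y. g y \<partial>\<nu>)) F"
  shows "limitin weak_top \<nu>s \<nu> F"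
proof -
  have *: "\<nu> \<in> U \<longrightarrow> (\<forall>\<^sub>F i in F. \<nu>s i \<in> U)"
    if "generate_topology_on {{\<nu> \<in> prob_borel. (\<integral>y. g y \<partial>\<nu>) \<in> U} | g U. g \<in> bcont \<and> open U} U" for U
    using that
  proof induction
    case (UN K)
    show ?case
    proof
      assume "\<nu> \<in> \<Union>K"
      then obtain k where k: "k \<in> K" "\<nu> \<in> k" by blast
      with UN(2) have "\<forall>\<^sub>F i in F. \<nu>s i \<in> k" by blast
      then show "\<forall>\<^sub>F i in F. \<nu>s i \<in> \<Union>K" by eventually_elim (use k in blast)
    qed
  next
    case (Basis s)
    then obtain g U where "s = {\<nu> \<in> prob_borel. (\<integral>y. g y \<partial>\<nu>) \<in> U}" "g \<in> bcont" "open U" by blast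
    then show ?case using topological_tendstoD[OF conv, of g U] \<nu>s by auto
  qed (auto simp: eventually_conj_iff)
  show ?thesis
    unfolding limitin_def topspace_weak_top
    using * \<nu> by (auto simp: weak_top_def dest!: openin_topology_generated_by)
qed

lemma bcont_psi_tendsto:
  assumes G: "G \<in> bcont_psi" and x: "(xs \<longlongrightarrow> x) F"
    and "\<And>i. \<nu>s i \<in> prob_borel" "\<nu> \<in> prob_borel"
    and "\<And>g. g \<in> bcont \<Longrightarrow> ((\<lambda>i. \<integral>y. g y \<partial>\<nu>s i) \<longlongrightarrow> (\<integral>y. g y \<partial>\<nu>)) F"
  shows "((\<lambda>i. G (xs i, \<nu>s i)) \<longlongrightarrow> G (x, \<nu>)) F"
proof -
  have "limitin (prod_topology euclidean weak_top) (\<lambda>i. (xs i, \<nu>s i)) (x, \<nu>) F"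
    using limitin_weak_top[OF assms(3-5)] x
    by (simp add: limitin_pairwise o_def)
  from continuous_map_limit[OF _ this, of euclideanreal G] G
  show ?thesis by (simp add: bcont_psi_def o_def)
qed

lemma bcont_psi_bounded:
  assumes "G \<in> bcont_psi"
  obtains C where "\<And>x \<nu>. \<nu> \<in> prob_borel \<Longrightarrow> \<bar>G (x, \<nu>)\<bar> \<le> C"
  using assms unfolding bcont_psi_def bounded_iff
  by (force simp: topspace_weak_top)

section \<open>Measurability\<close>

text \<open>A list of pairs (q, j) encodes the maximum of 0 and the functions q times the indicator
  of \<open>U j\<close>. Rational heights and indices of basic sets make the codes a countable type,
  so integrals of these functions give countably many coordinates of a measure.\<close>

fun upper_step :: "(nat \<Rightarrow> 'b set) \<Rightarrow> (rat \<times> nat) list \<Rightarrow> 'b \<Rightarrow> real" where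
  "upper_step U [] y = 0"
| "upper_step U (p # l) y = max (of_rat (fst p) * indicator (U (snd p)) y) (upper_step U l y)"

lemma upper_step_measurable:
  assumes "\<And>j. open (U j)"
  shows "upper_step U l \<in> borel_measurable borel"
proof (induction l)
  case (Cons p l)
  have [measurable]: "U j \<in> sets borel" for j using assms by auto
  show ?case using Cons by simp
qed simp

lemma upper_step_nonneg: "0 \<le> upper_step U l y"
  by (induction l) auto

lemma upper_step_le:
  assumes "\<And>p y. p \<in> set l \<Longrightarrow> y \<in> U (snd p) \<Longrightarrow> of_rat (fst p) \<le> g y" "\<And>y. 0 \<le> g y"
  shows "upper_step U l y \<le> g y"
  using assms by (induction l) (auto simp: indicator_def)

lemma upper_step_ge:
  assumes "p \<in> set l" "y \<in> U (snd p)"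
  shows "of_rat (fst p) \<le> upper_step U l y"
  using assms by (induction l) (auto simp: max_def)

text \<open>A nonnegative continuous function is the supremum of the countably many rational
  multiples of indicators of basic open sets that lie below it. Maxima over initial segments of an
  enumeration then converge pointwise.\<close>

lemma upper_step_approx:
  fixes U :: "nat \<Rightarrow> 'b::topological_space set" and g :: "'b \<Rightarrow> real"
  assumes U: "topological_basis (range U)" and g: "continuous_on UNIV g" and g0: "\<And>y. 0 \<le> g y"
  obtains l where "\<And>k y. upper_step U (l k) y \<le> g y" "\<And>y. (\<lambda>k. upper_step U (l k) y) \<longlonglongrightarrow> g y"
proof -
  define I where "I = {p. \<forall>y\<in>U (snd p). of_rat (fst p) \<le> g y}"
  have "I \<noteq> {}" using g0 by (auto simp: I_def intro!: exI[of _ 0])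
  define c where "c = from_nat_into I"
  have c: "range c = I" unfolding c_def by (rule range_from_nat_into[OF \<open>I \<noteq> {}\<close>]) auto
  define l where "l k = map c [0..<k]" for k
  have le: "upper_step U (l k) y \<le> g y" for k y
    by (rule upper_step_le) (use c g0 in \<open>auto simp: l_def I_def\<close>)
  have "(\<lambda>k. upper_step U (l k) y) \<longlonglongrightarrow> g y" for y
  proof (rule tendstoI)
    fix e :: real assume "e > 0"
    \<comment> \<open>By continuity \<open>g\<close> exceeds \<open>q\<close> on a basic
      neighbourhood \<open>U j\<close> of \<open>y\<close>, so (q, j) is admissible and already
      brings the maximum within \<open>e\<close> of \<open>g y\<close>.\<close>
    then obtain q where q: "g y - e < of_rat q" "of_rat q < g y"
      using of_rat_dense[of "g y - e" "g y"] by auto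
    have "open {z. of_rat q < g z}"
      using open_Collect_less[OF continuous_on_const g] .
    with q U obtain j where j: "y \<in> U j" "U j \<subseteq> {z. of_rat q < g z}"
      by (metis (no_types, lifting) topological_basisE mem_Collect_eq rangeE)
    then have "(q, j) \<in> I" by (auto simp: I_def)
    then obtain k0 where k0: "c k0 = (q, j)" using c by (metis rangeE)
    \<comment> \<open>The inequality is strict because \<open>[0..<k]\<close> contains
      \<open>k0\<close> only from \<open>k0 + 1\<close> on.\<close>
    have "of_rat q \<le> upper_step U (l k) y" if "k > k0" for k
      
    proof -
      have "(q, j) \<in> set (l k)" using that k0 by (auto simp: l_def image_iff intro!: bexI[of _ k0])
      from upper_step_ge[OF this, of y U] j show ?thesis by simp
    qed
    then have "\<bar>upper_step U (l k) y - g y\<bar> < e" if "k > k0" for k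
      using le[of k y] q that by fastforce
    then show "\<forall>\<^sub>F k in sequentially. dist (upper_step U (l k) y) (g y) < e"
      unfolding dist_real_def eventually_sequentially by (meson Suc_le_eq)
  qed
  with le show ?thesis using that by blast
qed

text \<open>The countably many coordinates \<open>e \<nu> l\<close> induce a topology finer than \<open>weak_top\<close>, so \<open>G\<close>
  factors through a continuous function on a subset of a second countable space.\<close>
lemma kernel_measurable:
  fixes \<kappa> :: "'a::polish_space \<Rightarrow> 'b::polish_space measure"
  assumes \<kappa>: "\<And>x. \<kappa> x \<in> prob_borel"
    and \<kappa>m: "\<And>B. B \<in> sets borel \<Longrightarrow> (\<lambda>x. emeasure (\<kappa> x) B) \<in> borel_measurable borel"
    and G: "G \<in> bcont_psi"
  shows "(\<lambda>x. G (x, \<kappa> x)) \<in> borel_measurable borel"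
proof -
  obtain B :: "'b set set" where B: "countable B" "topological_basis B"
    using ex_countable_basis by blast
  have "B \<noteq> {}" using topological_basisE[OF B(2) open_UNIV] by (metis UNIV_I empty_iff)
  define U where "U = from_nat_into B"
  have U: "topological_basis (range U)" using B \<open>B \<noteq> {}\<close> by (simp add: U_def range_from_nat_into)
  then have Uo: "open (U j)" for j by (auto intro: topological_basis_open)
  define e where "e \<nu> = (\<lambda>l. \<integral>y. upper_step U l y \<partial>\<nu>)" for \<nu>
  \<comment> \<open>Convergence of the coordinates alone implies weak convergence, because the step
    functions supply the minorants required by \<open>weak_conv_lower_approx\<close>.\<close>
  have econv: "(\<lambda>i. \<integral>y. g y \<partial>\<nu>s i) \<longlonglongrightarrow> (\<integral>y. g y \<partial>\<nu>)"
    if \<nu>: "\<And>i. \<nu>s i \<in> prob_borel" "\<nu> \<in> prob_borel" and "\<And>l. (\<lambda>i. e (\<nu>s i) l) \<longlonglongrightarrow> e \<nu> l"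
      and g: "g \<in> bcont" for \<nu>s \<nu> g
  proof (rule weak_conv_lower_approx[OF \<nu> _ g])
    fix h :: "'b \<Rightarrow> real" assume h: "h \<in> bcont" "\<And>y. 0 \<le> h y"
    then have "continuous_on UNIV h" by (simp add: bcont_def)
    from upper_step_approx[OF U this h(2)] obtain l where
      "\<And>k y. upper_step U (l k) y \<le> h y" "\<And>y. (\<lambda>k. upper_step U (l k) y) \<longlonglongrightarrow> h y" by blast
    then show "\<exists>\<phi>. \<forall>k. \<phi> k \<in> borel_measurable borel \<and> (\<forall>y. 0 \<le> \<phi> k y \<and> \<phi> k y \<le> h y) \<and>
        (\<forall>y. (\<lambda>k. \<phi> k y) \<longlonglongrightarrow> h y) \<and> (\<lambda>i. \<integral>y. \<phi> k y \<partial>\<nu>s i) \<longlonglongrightarrow> (\<integral>y. \<phi> k y \<partial>\<nu>)"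
      using that(3) upper_step_measurable[of U, OF Uo] upper_step_nonneg[of U]
      by (intro exI[of _ "\<lambda>k. upper_step U (l k)"]) (simp add: e_def)
  qed
  define r where "r = inv_into prob_borel e"
  have r: "r w \<in> prob_borel" "e (r w) = w" if "w \<in> e ` prob_borel" for w
    using that by (auto simp: r_def inv_into_into f_inv_into_f)
  \<comment> \<open>A sequential argument suffices: the coordinates are indexed by a countable type,
    so their product topology is first countable.\<close>
  have cont: "continuous_on (UNIV \<times> e ` prob_borel) (\<lambda>p. G (fst p, r (snd p)))"
  proof (rule continuous_on_sequentiallyI)
    fix u and a :: "'a \<times> ((rat \<times> nat) list \<Rightarrow> real)"
    assume u: "\<forall>n. u n \<in> UNIV \<times> e ` prob_borel" and a: "a \<in> UNIV \<times> e ` prob_borel"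
      and lim: "u \<longlonglongrightarrow> a"
    have u': "snd (u n) \<in> e ` prob_borel" for n using u by (metis mem_Times_iff)
    have a': "snd a \<in> e ` prob_borel" using a by (metis mem_Times_iff)
    have "(\<lambda>i. snd (u i) l) \<longlonglongrightarrow> snd a l" for l
      using continuous_on_tendsto_compose[OF continuous_on_product_coordinates[of l] tendsto_snd[OF lim]]
      by simp
    then show "(\<lambda>n. G (fst (u n), r (snd (u n)))) \<longlonglongrightarrow> G (fst a, r (snd a))"
      by (intro bcont_psi_tendsto[OF G tendsto_fst[OF lim] r(1)[OF u'] r(1)[OF a']]
          econv[OF r(1)[OF u'] r(1)[OF a']]) (simp_all add: r(2)[OF u'] r(2)[OF a'])
  qed
  \<comment> \<open>The chosen preimage \<open>r (e (\<kappa> x))\<close> is a priori another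
    measure with the same coordinates as \<open>\<kappa> x\<close>. The constant sequence
    \<open>\<kappa> x\<close> converges weakly to it, so \<open>G\<close> cannot distinguish the
    two.\<close>
  have eq: "G (x, r (e (\<kappa> x))) = G (x, \<kappa> x)" for x
  proof -
    have *: "e (\<kappa> x) \<in> e ` prob_borel" using \<kappa> by blast
    have "(\<lambda>i::nat. G (x, \<kappa> x)) \<longlonglongrightarrow> G (x, r (e (\<kappa> x)))"
      by (intro bcont_psi_tendsto[OF G tendsto_const \<kappa> r(1)[OF *]] econv[OF \<kappa> r(1)[OF *]])
        (simp_all add: r(2)[OF *])
    then show ?thesis using LIMSEQ_unique tendsto_const by blast
  qed
  \<comment> \<open>Setwise measurability makes \<open>\<kappa>\<close> a measurable kernel, so each
    coordinate of \<open>e (\<kappa> x)\<close> depends measurably on \<open>x\<close>.\<close>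
  have K: "\<kappa> \<in> borel \<rightarrow>\<^sub>M subprob_algebra borel"
    by (rule measurable_subprob_algebra)
      (use \<kappa> \<kappa>m in \<open>auto simp: prob_borel_def intro: prob_space_imp_subprob_space\<close>)
  have "(\<lambda>x. e (\<kappa> x)) \<in> borel_measurable borel"
  proof (rule measurable_coordinatewise_then_product)
    fix l
    show "(\<lambda>x. e (\<kappa> x) l) \<in> borel_measurable borel"
      unfolding e_def
      by (rule measurable_compose[OF K integral_measurable_subprob_algebra])
        (rule upper_step_measurable[OF Uo])
  qed
  then have "(\<lambda>x. (x, e (\<kappa> x))) \<in> borel \<rightarrow>\<^sub>M (borel :: ('a \<times> ((rat \<times> nat) list \<Rightarrow> real)) measure)"
    by (simp add: borel_prod[symmetric])
  then have "(\<lambda>x. (x, e (\<kappa> x))) \<in> borel \<rightarrow>\<^sub>M restrict_space borel (UNIV \<times> e ` prob_borel)"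
    using \<kappa> by (intro measurable_restrict_space2) auto
  from measurable_compose[OF this borel_measurable_continuous_on_restrict[OF cont]]
  show ?thesis by (simp add: eq)
qed

section \<open>An extended continuous mapping theorem\<close>

text \<open>For fixed \<open>k\<close> the envelope bounds \<open>hs n\<close> almost surely for all
  large \<open>n\<close>, and it is a bounded continuous function, so weak convergence transfers its
  integral to \<open>P\<close>. Letting \<open>k\<close> grow, dominated convergence brings this
  bound down to the integral of \<open>h\<close>. In \<open>key\<close> the index sequence
  \<open>m\<close> is arbitrary because the indices of near-maximisers tend to infinity without
  being prescribed.\<close>

lemma extended_continuous_mapping_upper:
  fixes Ps :: "nat \<Rightarrow> 'a::metric_space measure" and h :: "'a \<Rightarrow> real"
  assumes Ps: "\<And>n. Ps n \<in> prob_borel" and P: "P \<in> prob_borel" and conv: "weak_star_conv Ps P"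
    and hs_m: "\<And>n. hs n \<in> borel_measurable borel" and h_m: "h \<in> borel_measurable borel"
    and hs_bd: "\<And>n x. \<bar>hs n x\<bar> \<le> C" and h_bd: "\<And>x. \<bar>h x\<bar> \<le> C"
    and Ds: "\<And>n. AE x in Ps n. x \<in> Ds n" and D: "AE x in P. x \<in> D"
    and key: "\<And>m y x. filterlim m at_top sequentially \<Longrightarrow> y \<longlonglongrightarrow> x \<Longrightarrow> x \<in> D \<Longrightarrow>
      (\<And>k. y k \<in> Ds (m k)) \<Longrightarrow> (\<lambda>k. hs (m k) (y k)) \<longlonglongrightarrow> h x"
    and e: "e > 0"
  shows "\<forall>\<^sub>F n in sequentially. (\<integral>x. hs n x \<partial>Ps n) < (\<integral>x. h x \<partial>P) + e"
proof -
  text \<open>\<open>L k\<close> is \<open>k\<close>-Lipschitz, dominates \<open>hs n\<close> on \<open>Ds n\<close> for \<open>n \<ge> k\<close>, and has upper limit at most \<open>h\<close> on \<open>D\<close>.\<close>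
  define t where "t k x p = max (-C) (hs (fst p) (snd p) - real k * dist x (snd p))" for k x p
  define I where "I k = {p :: nat \<times> 'a. fst p \<ge> k \<and> snd p \<in> Ds (fst p)}" for k
  define L where "L k x = (SUP p\<in>I k. t k x p)" for k x
  have C: "0 \<le> C" using h_bd[of undefined] by linarith
  \<comment> \<open>A set of full measure under a probability measure is nonempty, so the suprema
    range over nonempty index sets.\<close>
  have I: "I k \<noteq> {}" for k
  proof -
    interpret prob_space "Ps k" using Ps by (simp add: prob_borel_def)
    obtain y where "y \<in> Ds k" using Ds[of k] AE_contr by fastforce
    then have "(k, y) \<in> I k" by (simp add: I_def)
    then show ?thesis by blast
  qed
  have t_le: "t k x p \<le> C" for k x p
  proof -
    have "0 \<le> real k * dist x (snd p)" by simp
    moreover have "hs (fst p) (snd p) \<le> C" using hs_bd[of "fst p" "snd p"] by linarith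
    ultimately have "hs (fst p) (snd p) - real k * dist x (snd p) \<le> C" by linarith
    moreover have "- C \<le> C" using C by linarith
    ultimately show ?thesis unfolding t_def by (rule max.boundedI[rotated])
  qed
  have bdd: "bdd_above (t k x ` I k)" for k x by (rule bdd_aboveI2) (rule t_le)
  have L_ge: "t k x p \<le> L k x" if "p \<in> I k" for k x p
    unfolding L_def by (rule cSUP_upper[OF that bdd])
  \<comment> \<open>The truncation at \<open>-C\<close> in \<open>t\<close> provides the lower
    bound; without it the distance penalty could be arbitrarily large.\<close>
  have L_bd: "\<bar>L k x\<bar> \<le> C" for k x
  proof -
    have "L k x \<le> C" unfolding L_def using I t_le by (intro cSUP_least) auto
    moreover obtain p where "p \<in> I k" using I by blast
    then have "- C \<le> L k x" using L_ge[of p k x] unfolding t_def by linarith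
    ultimately show ?thesis by linarith
  qed
  have L_lip: "L k x \<le> L k z + real k * dist x z" for k x z
    unfolding L_def[of k x]
  proof (rule cSUP_least[OF I])
    fix p assume p: "p \<in> I k"
    have "dist z (snd p) \<le> dist x z + dist x (snd p)" by (metis dist_commute dist_triangle2)
    then have "real k * dist z (snd p) \<le> real k * dist x z + real k * dist x (snd p)"
      by (metis distrib_left mult_left_mono of_nat_0_le_iff)
    moreover have "0 \<le> real k * dist x z" by simp
    ultimately have "t k x p \<le> t k z p + real k * dist x z" unfolding t_def by linarith
    with L_ge[OF p, of z] show "t k x p \<le> L k z + real k * dist x z" by linarith
  qed
  have "k-lipschitz_on UNIV (L k)" for k
  proof (rule lipschitz_onI)
    fix x z show "dist (L k x) (L k z) \<le> real k * dist x z"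
      using L_lip[of k x z] L_lip[of k z x] by (simp add: dist_real_def dist_commute abs_le_iff)
  qed simp
  then have Lc: "L k \<in> bcont" for k
    using L_bd by (intro bcontI) (auto intro: lipschitz_on_continuous_on)
  \<comment> \<open>If this failed, near-maximisers for arbitrarily large \<open>k\<close> would
    exceed \<open>h x\<close> by a fixed amount. The penalty forces their points towards
    \<open>x\<close>, and \<open>key\<close> gives a contradiction. The maximum with
    \<open>h x\<close> appears because \<open>L k x\<close> may fall below \<open>h x\<close>; only
    its upper limit matters.\<close>
  have L_lim: "(\<lambda>k. max (L k x) (h x)) \<longlonglongrightarrow> h x" if x: "x \<in> D" for x
  proof (rule ccontr)
    assume "\<not> ?thesis"
    then obtain d where d: "d > 0"
        "\<not> (\<forall>\<^sub>F k in sequentially. dist (max (L k x) (h x)) (h x) < d)"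
      unfolding tendsto_iff by blast
    have "\<exists>k\<ge>N. L k x \<ge> h x + d" for N
      using d unfolding eventually_sequentially dist_real_def by (force simp: max_def split: if_splits)
    then obtain j where j: "\<And>N. j N \<ge> N" "\<And>N. L (j N) x \<ge> h x + d" by metis
    have "\<exists>p\<in>I (j N). t (j N) x p > h x + d / 2" for N
    proof -
      have "h x + d / 2 < L (j N) x" using j(2)[of N] d(1) by linarith
      then show ?thesis unfolding L_def by (simp add: less_cSUP_iff[OF I bdd])
    qed
    then obtain p where p: "\<And>N. p N \<in> I (j N)" "\<And>N. t (j N) x (p N) > h x + d / 2" by metis
    \<comment> \<open>Since \<open>h x\<close> is at least \<open>-C\<close>, the value is strictly
      above the truncation level, so the other term attains the maximum in \<open>t\<close>.\<close>
    have *: "hs (fst (p N)) (snd (p N)) - real (j N) * dist x (snd (p N)) > h x + d / 2" for N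
      using p(2)[of N] h_bd[of x] d(1) unfolding t_def by (auto simp: less_max_iff_disj abs_le_iff)
    \<comment> \<open>The penalty is at most the gap between two numbers in [-C, C], hence at most 2
      C, while its factor \<open>j N\<close> is at least \<open>N\<close>.\<close>
    have dist: "dist (snd (p N)) x \<le> 2 * C / real N" if "N > 0" for N
    proof -
      have "real N * dist x (snd (p N)) \<le> real (j N) * dist x (snd (p N))"
        using j(1) by (intro mult_right_mono) auto
      also have "\<dots> \<le> 2 * C"
        using *[of N] hs_bd[of "fst (p N)" "snd (p N)"] h_bd[of x] d(1) by (simp add: abs_le_iff)
      finally show ?thesis using that by (simp add: field_simps dist_commute)
    qed
    have "(\<lambda>N. dist (snd (p N)) x) \<longlonglongrightarrow> 0"
    proof (rule tendsto_sandwich[of "\<lambda>_. 0" _ _ "\<lambda>N. 2 * C / real N"])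
      show "(\<lambda>N. 2 * C / real N) \<longlonglongrightarrow> 0" by (rule lim_const_over_n)
      show "\<forall>\<^sub>F N in sequentially. dist (snd (p N)) x \<le> 2 * C / real N"
        using eventually_gt_at_top[of 0] by eventually_elim (rule dist)
    qed simp_all
    then have lim: "(\<lambda>N. snd (p N)) \<longlonglongrightarrow> x" by (rule tendsto_dist_iff[THEN iffD2])
    have top: "filterlim (\<lambda>N. fst (p N)) at_top sequentially"
    proof (rule filterlim_at_top_mono[OF filterlim_ident], rule always_eventually, rule allI)
      fix N show "N \<le> fst (p N)" using p(1)[of N] j(1)[of N] by (simp add: I_def)
    qed
    have "snd (p N) \<in> Ds (fst (p N))" for N using p(1) by (simp add: I_def)
    from key[OF top lim x this]
    have "(\<lambda>N. hs (fst (p N)) (snd (p N))) \<longlonglongrightarrow> h x" .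
    then have "\<forall>\<^sub>F N in sequentially. hs (fst (p N)) (snd (p N)) < h x + d / 2"
      using d(1) by (intro order_tendstoD) auto
    then obtain N where "hs (fst (p N)) (snd (p N)) < h x + d / 2"
      using eventually_happens by fastforce
    moreover have "0 \<le> real (j N) * dist x (snd (p N))" by simp
    ultimately show False using *[of N] by linarith
  qed
  have M_m: "(\<lambda>x. max (L k x) (h x)) \<in> borel_measurable borel" for k
    using bcont_measurable[OF Lc] h_m by measurable
  have M_bd: "\<bar>max (L k x) (h x)\<bar> \<le> C" for k x using L_bd[of k x] h_bd[of x] by linarith
  have "(\<lambda>k. \<integral>x. max (L k x) (h x) \<partial>P) \<longlonglongrightarrow> (\<integral>x. h x \<partial>P)"
    by (rule prob_borel_dominated_convergence[OF P M_m h_m M_bd])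
      (use D L_lim in \<open>auto elim!: eventually_mono\<close>)
  then have "\<forall>\<^sub>F k in sequentially. (\<integral>x. max (L k x) (h x) \<partial>P) < (\<integral>x. h x \<partial>P) + e"
    using e by (intro order_tendstoD) auto
  then obtain k where "(\<integral>x. max (L k x) (h x) \<partial>P) < (\<integral>x. h x \<partial>P) + e"
    using eventually_happens by fastforce
  moreover have "(\<integral>x. L k x \<partial>P) \<le> (\<integral>x. max (L k x) (h x) \<partial>P)"
    by (rule prob_borel_integral_mono[OF P bcont_measurable[OF Lc] L_bd M_m M_bd]) simp
  ultimately have k: "(\<integral>x. L k x \<partial>P) < (\<integral>x. h x \<partial>P) + e" by linarith
  have "(\<lambda>n. \<integral>x. L k x \<partial>Ps n) \<longlonglongrightarrow> (\<integral>x. L k x \<partial>P)"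
    using conv Lc unfolding weak_star_conv_def by blast
  then have "\<forall>\<^sub>F n in sequentially. (\<integral>x. L k x \<partial>Ps n) < (\<integral>x. h x \<partial>P) + e"
    using k by (intro order_tendstoD(2))
  \<comment> \<open>The envelope \<open>L k\<close> takes only indices from \<open>k\<close> on into
    account, so it dominates \<open>hs n\<close> only for these \<open>n\<close>.\<close>
  moreover have "\<forall>\<^sub>F n in sequentially. n \<ge> k" by (rule eventually_ge_at_top)
  ultimately show ?thesis
  proof eventually_elim
    case (elim n)
    have "(\<integral>x. hs n x \<partial>Ps n) \<le> (\<integral>x. L k x \<partial>Ps n)"
    proof (rule integral_mono_AE)
      show "AE x in Ps n. hs n x \<le> L k x"
        using Ds[of n]
      proof eventually_elim
        case (elim x)
        then have "(n, x) \<in> I k" using \<open>n \<ge> k\<close> by (simp add: I_def)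
        from L_ge[OF this, of x] show ?case by (simp add: t_def)
      qed
    qed (intro prob_borel_integrable[OF Ps hs_m hs_bd]
          prob_borel_integrable[OF Ps bcont_measurable[OF Lc] L_bd])+
    with elim show ?case by linarith
  qed
qed

text \<open>The hypotheses are symmetric under a change of sign, so the upper bound applies to
  \<open>hs\<close> and to its negative.\<close>

lemma extended_continuous_mapping:
  fixes Ps :: "nat \<Rightarrow> 'a::metric_space measure" and h :: "'a \<Rightarrow> real"
  assumes Ps: "\<And>n. Ps n \<in> prob_borel" and P: "P \<in> prob_borel" and conv: "weak_star_conv Ps P"
    and hs_m: "\<And>n. hs n \<in> borel_measurable borel" and h_m: "h \<in> borel_measurable borel"
    and hs_bd: "\<And>n x. \<bar>hs n x\<bar> \<le> C" and h_bd: "\<And>x. \<bar>h x\<bar> \<le> C"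
    and Ds: "\<And>n. AE x in Ps n. x \<in> Ds n" and D: "AE x in P. x \<in> D"
    and key: "\<And>m y x. filterlim m at_top sequentially \<Longrightarrow> y \<longlonglongrightarrow> x \<Longrightarrow> x \<in> D \<Longrightarrow>
      (\<And>k. y k \<in> Ds (m k)) \<Longrightarrow> (\<lambda>k. hs (m k) (y k)) \<longlonglongrightarrow> h x"
  shows "(\<lambda>n. \<integral>x. hs n x \<partial>Ps n) \<longlonglongrightarrow> (\<integral>x. h x \<partial>P)"
proof (rule tendstoI)
  fix e :: real assume e: "e > 0"
  have "\<forall>\<^sub>F n in sequentially. (\<integral>x. hs n x \<partial>Ps n) < (\<integral>x. h x \<partial>P) + e"
    by (rule extended_continuous_mapping_upper[OF Ps P conv hs_m h_m hs_bd h_bd Ds D key e])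
  moreover have "\<forall>\<^sub>F n in sequentially. (\<integral>x. - hs n x \<partial>Ps n) < (\<integral>x. - h x \<partial>P) + e"
  proof (rule extended_continuous_mapping_upper[OF Ps P conv _ _ _ _ Ds D _ e])
    fix m y x assume "filterlim m at_top sequentially" "y \<longlonglongrightarrow> x" "x \<in> D" "\<And>k. y k \<in> Ds (m k)"
    from tendsto_minus[OF key[OF this]] show "(\<lambda>k. - hs (m k) (y k)) \<longlonglongrightarrow> - h x" .
  qed (use hs_m h_m hs_bd h_bd in auto)
  ultimately show "\<forall>\<^sub>F n in sequentially. dist (\<integral>x. hs n x \<partial>Ps n) (\<integral>x. h x \<partial>P) < e"
  proof eventually_elim
    case (elim n)
    then have "(\<integral>x. h x \<partial>P) - e < (\<integral>x. hs n x \<partial>Ps n)" by simp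
    with elim(1) show ?case unfolding dist_real_def abs_less_iff by linarith
  qed
qed

section \<open>Conditional distributions given by a density\<close>

lemma marg_prob_borel:
  fixes \<mu> :: "('a::polish_space \<times> 'b::polish_space) measure"
  assumes "\<mu> \<in> prob_borel"
  shows "marg1 \<mu> \<in> prob_borel" "marg2 \<mu> \<in> prob_borel"
proof -
  interpret prob_space \<mu> using assms by (simp add: prob_borel_def)
  have S: "sets \<mu> = sets borel" using assms by (simp add: prob_borel_def)
  have "fst \<in> \<mu> \<rightarrow>\<^sub>M borel" "snd \<in> \<mu> \<rightarrow>\<^sub>M borel"
    unfolding measurable_cong_sets[OF S refl]
    by (auto intro!: borel_measurable_continuous_onI continuous_intros)
  then show "marg1 \<mu> \<in> prob_borel" "marg2 \<mu> \<in> prob_borel"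
    by (auto simp: marg1_def marg2_def prob_borel_def intro: prob_space_distr)
qed

lemma marg_weak_star_conv:
  fixes \<mu>s :: "nat \<Rightarrow> ('a::polish_space \<times> 'b::polish_space) measure"
  assumes "\<And>n. \<mu>s n \<in> prob_borel" "\<mu> \<in> prob_borel" "weak_star_conv \<mu>s \<mu>"
  shows "weak_star_conv (\<lambda>n. marg1 (\<mu>s n)) (marg1 \<mu>)" "weak_star_conv (\<lambda>n. marg2 (\<mu>s n)) (marg2 \<mu>)"
proof -
  have distr: "weak_star_conv (\<lambda>n. distr (\<mu>s n) borel p) (distr \<mu> borel p)"
    if p: "continuous_on UNIV p" for p :: "'a \<times> 'b \<Rightarrow> 'c::topological_space"
    unfolding weak_star_conv_def
  proof
    fix g :: "'c \<Rightarrow> real" assume g: "g \<in> bcont"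
    have I: "(\<integral>x. g x \<partial>distr \<nu> borel p) = (\<integral>z. g (p z) \<partial>\<nu>)" if "\<nu> \<in> prob_borel" for \<nu>
    proof (rule integral_distr[OF _ bcont_measurable[OF g]])
      have "sets \<nu> = sets borel" using that by (simp add: prob_borel_def)
      then show "p \<in> \<nu> \<rightarrow>\<^sub>M borel"
        using borel_measurable_continuous_onI[OF p] by (simp cong: measurable_cong_sets)
    qed
    obtain C where C: "\<And>y. \<bar>g y\<bar> \<le> C" using bcont_bounded[OF g] by metis
    have gc: "continuous_on UNIV g" using g by (simp add: bcont_def)
    have "continuous_on UNIV (\<lambda>z. g (p z))"
      by (rule continuous_on_compose2[OF gc p]) simp
    then have "(\<lambda>z. g (p z)) \<in> bcont" by (rule bcontI) (rule C)
    then show "(\<lambda>n. \<integral>x. g x \<partial>distr (\<mu>s n) borel p) \<longlonglongrightarrow> (\<integral>x. g x \<partial>distr \<mu> borel p)"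
      using assms(3) unfolding I[OF assms(1)] I[OF assms(2)] weak_star_conv_def by blast
  qed
  show "weak_star_conv (\<lambda>n. marg1 (\<mu>s n)) (marg1 \<mu>)" "weak_star_conv (\<lambda>n. marg2 (\<mu>s n)) (marg2 \<mu>)"
    unfolding marg1_def marg2_def
    by (rule distr[OF continuous_on_fst[OF continuous_on_id]]) (rule distr[OF continuous_on_snd[OF continuous_on_id]])
qed

text \<open>Countability allows a single exceptional null set for all members, stability under
  intersections lets them determine a measure, and \<open>UNIV\<close> serves as the exhausting set
  of finite measure. Finite intersections of a countable basis have all these properties, the empty
  family contributing \<open>UNIV\<close>.\<close>

lemma countable_Int_stable_basis:
  obtains E :: "'a::second_countable_topology set set"
  where "countable E" "topological_basis E" "Int_stable E" "UNIV \<in> E"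
proof -
  obtain B :: "'a set set" where B: "countable B" "topological_basis B"
    using ex_countable_basis by blast
  define E where "E = Inter ` {F. finite F \<and> F \<subseteq> B}"
  have "countable E" unfolding E_def
    using countable_Collect_finite_subset[OF B(1)] by auto
  moreover have "topological_basis E"
  proof (rule topological_basisI)
    fix S assume "S \<in> E" then show "open S"
      unfolding E_def using B(2) by (auto intro!: open_Inter intro: topological_basis_open)
  next
    fix S x assume "open S" "x \<in> (S :: 'a set)"
    then obtain b where "b \<in> B" "x \<in> b" "b \<subseteq> S" using topological_basisE[OF B(2)] by metis
    moreover from \<open>b \<in> B\<close> have "b \<in> E" by (auto simp: E_def image_iff intro!: exI[of _ "{b}"])
    ultimately show "\<exists>b\<in>E. x \<in> b \<and> b \<subseteq> S" by blast
  qed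
  moreover have "Int_stable E"
  proof (rule Int_stableI)
    fix a b assume "a \<in> E" "b \<in> E"
    then obtain F F' where "a = \<Inter>F" "b = \<Inter>F'" "finite F" "F \<subseteq> B" "finite F'" "F' \<subseteq> B"
      by (auto simp: E_def)
    then show "a \<inter> b \<in> E" unfolding E_def by (intro image_eqI[of _ _ "F \<union> F'"]) auto
  qed
  moreover have "UNIV \<in> E" unfolding E_def by (intro image_eqI[of _ _ "{}"]) auto
  ultimately show ?thesis using that by blast
qed

lemma borel_measurable_section:
  fixes u :: "'a::topological_space \<times> 'b::topological_space \<Rightarrow> 'c::topological_space"
  assumes "u \<in> borel_measurable borel"
  shows "(\<lambda>y. u (z, y)) \<in> borel_measurable borel"
  by (rule measurable_compose[OF _ assms])
    (auto intro!: borel_measurable_continuous_onI continuous_intros)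

text \<open>For fixed B, both sides evaluated at B are densities, with respect to the first
  marginal, of the finite measure sending A to the \<open>\<mu>\<close>-measure of A times B; hence
  they agree almost everywhere. A countable intersection-stable basis then upgrades this to equality
  of measures at almost every point.\<close>

lemma rcd_eq_density:
  fixes \<mu> :: "('a::polish_space \<times> 'b::polish_space) measure"
  assumes \<mu>: "\<mu> \<in> prob_borel" and f: "f \<in> borel_measurable borel"
    and dens: "\<mu> = density (marg1 \<mu> \<Otimes>\<^sub>M marg2 \<mu>) (\<lambda>z. ennreal (f z))"
    and \<kappa>: "rcd \<mu> \<kappa>"
  shows "AE x in marg1 \<mu>. \<kappa> x = density (marg2 \<mu>) (\<lambda>y. ennreal (f (x, y)))"
proof -
  let ?P = "marg1 \<mu>" and ?Q = "marg2 \<mu>"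
  have PQ: "?P \<in> prob_borel" "?Q \<in> prob_borel" using marg_prob_borel[OF \<mu>] by auto
  then have SP [measurable_cong]: "sets ?P = sets borel" and SQ [measurable_cong]: "sets ?Q = sets borel"
    by (auto simp: prob_borel_def)
  interpret P: prob_space ?P using PQ by (simp add: prob_borel_def)
  interpret Q: prob_space ?Q using PQ by (simp add: prob_borel_def)
  have [measurable]: "f \<in> borel_measurable (?P \<Otimes>\<^sub>M ?Q)"
    using f by (simp add: borel_prod[symmetric] cong: measurable_cong_sets sets_pair_measure_cong)
  have \<kappa>p: "\<kappa> x \<in> prob_borel" for x using \<kappa> by (simp add: rcd_def)
  have eq: "AE x in ?P. emeasure (\<kappa> x) B = (\<integral>\<^sup>+y. ennreal (f (x, y)) * indicator B y \<partial>?Q)"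
    if B: "B \<in> sets borel" for B
  proof (rule P.density_unique_finite_measure)
    have [measurable]: "(\<lambda>x. emeasure (\<kappa> x) B) \<in> borel_measurable borel"
      using \<kappa> B by (simp add: rcd_def)
    show "(\<lambda>x. emeasure (\<kappa> x) B) \<in> borel_measurable ?P" by measurable
    have [measurable]: "B \<in> sets ?Q" using B SQ by simp
    show "(\<lambda>x. \<integral>\<^sup>+y. ennreal (f (x, y)) * indicator B y \<partial>?Q) \<in> borel_measurable ?P"
      by measurable
    fix A assume A [measurable]: "A \<in> sets ?P"
    then have "A \<in> sets borel" using SP by simp
    then have "(\<integral>\<^sup>+x. emeasure (\<kappa> x) B * indicator A x \<partial>?P) = emeasure \<mu> (A \<times> B)"
      using \<kappa> B by (simp add: rcd_def)
    also have "\<dots> = emeasure (density (?P \<Otimes>\<^sub>M ?Q) (\<lambda>z. ennreal (f z))) (A \<times> B)"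
      using dens by simp
    also have "\<dots> = (\<integral>\<^sup>+z. ennreal (f z) * indicator (A \<times> B) z \<partial>(?P \<Otimes>\<^sub>M ?Q))"
      by (rule emeasure_density) measurable
    also have "\<dots> = (\<integral>\<^sup>+x. \<integral>\<^sup>+y. ennreal (f (x, y)) * indicator (A \<times> B) (x, y) \<partial>?Q \<partial>?P)"
      by (rule Q.nn_integral_fst[symmetric]) measurable
    also have "\<dots> = (\<integral>\<^sup>+x. (\<integral>\<^sup>+y. ennreal (f (x, y)) * indicator B y \<partial>?Q) * indicator A x \<partial>?P)"
      by (intro nn_integral_cong) (auto simp: indicator_def)
    finally show "(\<integral>\<^sup>+x. emeasure (\<kappa> x) B * indicator A x \<partial>?P) =
      (\<integral>\<^sup>+x. (\<integral>\<^sup>+y. ennreal (f (x, y)) * indicator B y \<partial>?Q) * indicator A x \<partial>?P)" .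
  qed auto
  obtain E :: "'b set set" where E: "countable E" "topological_basis E" "Int_stable E" "UNIV \<in> E"
    by (rule countable_Int_stable_basis)
  then have bE: "sets borel = sigma_sets UNIV E"
    by (simp add: borel_eq_countable_basis[OF E(1,2)])
  have "AE x in ?P. \<forall>B\<in>E. emeasure (\<kappa> x) B = (\<integral>\<^sup>+y. ennreal (f (x, y)) * indicator B y \<partial>?Q)"
    unfolding AE_ball_countable[OF E(1)]
    using eq topological_basis_open[OF E(2)] by (auto intro: borel_open)
  then show ?thesis
  proof eventually_elim
    case (elim x)
    have [measurable]: "(\<lambda>y. f (x, y)) \<in> borel_measurable ?Q"
      using borel_measurable_section[OF f, of x] measurable_cong_sets[OF SQ refl] by blast
    show ?case
    proof (rule measure_eqI_generator_eq[OF E(3), of UNIV _ _ "\<lambda>_. UNIV"])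
      fix B assume "B \<in> E"
      then have "B \<in> sets ?Q" using bE SQ by auto
      then show "emeasure (\<kappa> x) B = emeasure (density ?Q (\<lambda>y. ennreal (f (x, y)))) B"
        using elim \<open>B \<in> E\<close> by (simp add: emeasure_density)
    next
      interpret K: prob_space "\<kappa> x" using \<kappa>p by (simp add: prob_borel_def)
      show "emeasure (\<kappa> x) UNIV \<noteq> \<infinity>" by (rule K.emeasure_finite[unfolded infinity_ennreal_def[symmetric]])
      show "sets (\<kappa> x) = sigma_sets UNIV E" using \<kappa>p bE by (simp add: prob_borel_def)
      show "sets (density ?Q (\<lambda>y. ennreal (f (x, y)))) = sigma_sets UNIV E" using SQ bE by simp
    qed (use E in auto)
  qed
qed

section \<open>Densities converging locally uniformly\<close>

text \<open>Countably many open balls with compact closed balls cover the space. Tent functions on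
  the first \<open>k\<close> of them, summed, scaled by \<open>k\<close> and capped at 1, vanish off
  a finite union of compact balls and eventually equal 1 at every point.\<close>

lemma compact_cutoffs:
  assumes "locally_compact_space (euclidean :: 'b::polish_space topology)"
  obtains \<theta> :: "nat \<Rightarrow> 'b::polish_space \<Rightarrow> real" and K :: "nat \<Rightarrow> 'b::polish_space set" where
    "\<And>k. continuous_on UNIV (\<theta> k)" "\<And>k y. 0 \<le> \<theta> k y" "\<And>k y. \<theta> k y \<le> 1"
    "\<And>k. compact (K k)" "\<And>k y. y \<notin> K k \<Longrightarrow> \<theta> k y = 0" "\<And>y. (\<lambda>k. \<theta> k y) \<longlonglongrightarrow> 1"
proof -
  obtain S :: "'b set" where S: "countable S" "\<And>U. open U \<Longrightarrow> U \<noteq> {} \<Longrightarrow> \<exists>c\<in>S. c \<in> U"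
    using countable_dense_setE by blast
  define I where "I = {p :: 'b \<times> rat. fst p \<in> S \<and> compact (cball (fst p) (of_rat (snd p)))}"
  have "countable I"
    by (rule countable_subset[of _ "S \<times> UNIV"]) (use S in \<open>auto simp: I_def\<close>)
  have cover: "\<exists>p\<in>I. dist y (fst p) < of_rat (snd p)" for y
  proof -
    obtain U C where "open U" "compact C" "y \<in> U" "U \<subseteq> C"
      
    proof -
      have "\<exists>U C. open U \<and> compact C \<and> y \<in> U \<and> U \<subseteq> C"
        using assms unfolding locally_compact_space_def by simp
      then show ?thesis using that by blast
    qed
    then obtain e where e: "e > 0" "cball y e \<subseteq> C" by (meson open_contains_cball subset_trans)
    \<comment> \<open>The radius is below \<open>e / 2\<close> so that the closed ball about a dense
      point within \<open>q\<close> of \<open>y\<close> stays inside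
      \<open>cball y e\<close>.\<close>
    obtain q where q: "0 < real_of_rat q" "real_of_rat q < e / 2"
      using of_rat_dense[of 0 "e / 2"] e by auto
    obtain c where c: "c \<in> S" "c \<in> ball y (of_rat q)" using S(2)[of "ball y (of_rat q)"] q by auto
    have "cball c (of_rat q) \<subseteq> cball y e"
    proof
      fix z assume "z \<in> cball c (of_rat q)"
      with c q dist_triangle[of y z c] show "z \<in> cball y e" by auto
    qed
    with e have "cball c (of_rat q) \<subseteq> C" by blast
    then have "compact (cball c (of_rat q))"
      using compact_Int_closed[OF \<open>compact C\<close> closed_cball] by (metis inf.absorb_iff2)
    with c show ?thesis by (intro bexI[of _ "(c, q)"]) (auto simp: I_def)
  qed
  then have "I \<noteq> {}" by blast
  define c where "c = from_nat_into I"
  have c: "range c = I" unfolding c_def by (rule range_from_nat_into[OF \<open>I \<noteq> {}\<close> \<open>countable I\<close>])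
  define w where "w j y = max 0 (of_rat (snd (c j)) - dist y (fst (c j)))" for j y
  \<comment> \<open>The growing factor \<open>k\<close> pushes the sum past 1 wherever some tent is
    positive, however small its value.\<close>
  define \<theta> where "\<theta> k y = min 1 (real k * (\<Sum>j<k. w j y))" for k y
  define K where "K k = (\<Union>j<k. cball (fst (c j)) (of_rat (snd (c j))))" for k
  have w0: "0 \<le> w j y" for j y by (simp add: w_def)
  show ?thesis
  proof
    fix k y
    show "continuous_on UNIV (\<theta> k)" unfolding \<theta>_def w_def by (intro continuous_intros)
    show "0 \<le> \<theta> k y" "\<theta> k y \<le> 1" unfolding \<theta>_def using w0 by (auto intro!: sum_nonneg mult_nonneg_nonneg)
    have "c j \<in> I" for j using c by blast
    then show "compact (K k)" unfolding K_def by (intro compact_UN) (auto simp: I_def)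
    show "\<theta> k y = 0" if "y \<notin> K k"
    proof -
      have "w j y = 0" if "j < k" for j
        using \<open>y \<notin> K k\<close> that by (auto simp: K_def w_def dist_commute not_le)
      then show ?thesis by (simp add: \<theta>_def)
    qed
    obtain p where "p \<in> I" "dist y (fst p) < of_rat (snd p)" using cover by blast
    moreover obtain j where "p = c j" using c \<open>p \<in> I\<close> by blast
    ultimately have j: "w j y > 0" by (simp add: w_def)
    obtain N :: nat where N: "1 / w j y < real N" using reals_Archimedean2 by blast
    \<comment> \<open>Exceeding \<open>j\<close> puts the tent \<open>w j\<close> into the sum;
      exceeding \<open>N\<close> makes the scaling factor large enough.\<close>
    have "\<theta> k y = 1" if k: "k > max j N" for k
    proof -
      have "1 \<le> real N * w j y" using N j by (simp add: field_simps)
      also have "\<dots> \<le> real k * (\<Sum>j<k. w j y)"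
        using k w0 by (intro mult_mono member_le_sum sum_nonneg) auto
      finally show ?thesis by (simp add: \<theta>_def)
    qed
    then have "\<forall>\<^sub>F k in sequentially. \<theta> k y = 1" unfolding eventually_sequentially by (meson Suc_le_eq)
    then show "(\<lambda>k. \<theta> k y) \<longlonglongrightarrow> 1" by (rule tendsto_eventually)
  qed
qed

text \<open>The compact support confines everything to one compact set, where the integrands with
  moving \<open>xs k\<close> and \<open>fs k\<close> approach the fixed bounded continuous integrand
  \<open>f (x, y) * \<phi> y\<close> uniformly. Weak convergence of \<open>Qs\<close> handles that
  fixed integrand.\<close>

lemma locally_uniform_density_vague:
  fixes Q :: "'b::polish_space measure" and f :: "'a::metric_space \<times> 'b \<Rightarrow> real"
  assumes Qs: "\<And>k. Qs k \<in> prob_borel" and Qconv: "weak_star_conv Qs Q"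
    and f_cont: "continuous_on UNIV f"
    and unif: "\<And>K. compact K \<Longrightarrow> uniform_limit K fs f sequentially"
    and x: "xs \<longlonglongrightarrow> x"
    and \<phi>: "continuous_on UNIV \<phi>" "\<And>y. \<bar>\<phi> y\<bar> \<le> C" and K: "compact K" "\<And>y. y \<notin> K \<Longrightarrow> \<phi> y = 0"
    and int: "\<And>k. integrable (Qs k) (\<lambda>y. fs k (xs k, y) * \<phi> y)"
  shows "(\<lambda>k. \<integral>y. fs k (xs k, y) * \<phi> y \<partial>Qs k) \<longlonglongrightarrow> (\<integral>y. f (x, y) * \<phi> y \<partial>Q)"
proof -
  have C: "0 \<le> C" using \<phi>(2)[of undefined] by linarith
  \<comment> \<open>A convergent sequence together with its limit is compact; this yields a compact
    set containing all pairs of points in play.\<close>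
  let ?Z = "insert x (range xs)"
  have Z: "compact (?Z \<times> K)"
    using compactin_sequence_with_limit[of euclidean xs x "range xs"] x K(1) by (simp add: compact_Times)
  have fx: "continuous_on UNIV (\<lambda>y. f (x, y))"
    by (rule continuous_on_compose2[OF f_cont]) (auto intro!: continuous_intros)
  have bc: "(\<lambda>y. f (x, y) * \<phi> y) \<in> bcont"
  proof -
    have "compact ((\<lambda>y. f (x, y)) ` K)"
      by (rule compact_continuous_image[OF continuous_on_subset[OF fx] K(1)]) simp
    then obtain B where B: "\<And>y. y \<in> K \<Longrightarrow> \<bar>f (x, y)\<bar> \<le> B"
      using compact_imp_bounded bounded_iff by (metis image_eqI real_norm_def)
    have "\<bar>f (x, y) * \<phi> y\<bar> \<le> \<bar>B\<bar> * C" for y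
    proof (cases "y \<in> K")
      case True
      then have "\<bar>f (x, y)\<bar> \<le> \<bar>B\<bar>" using B by force
      then show ?thesis using \<phi>(2)[of y] by (simp add: abs_mult mult_mono)
    qed (use K(2) C in simp)
    then show ?thesis by (intro bcontI) (auto intro!: continuous_intros fx \<phi>(1))
  qed
  then have conv: "(\<lambda>k. \<integral>y. f (x, y) * \<phi> y \<partial>Qs k) \<longlonglongrightarrow> (\<integral>y. f (x, y) * \<phi> y \<partial>Q)"
    using Qconv by (auto simp: weak_star_conv_def)
  obtain B where B: "\<And>y. \<bar>f (x, y) * \<phi> y\<bar> \<le> B" using bcont_bounded[OF bc] by metis
  have int': "integrable (Qs k) (\<lambda>y. f (x, y) * \<phi> y)" for k
    by (rule prob_borel_integrable[OF Qs bcont_measurable[OF bc] B])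
  have "(\<lambda>k. (\<integral>y. fs k (xs k, y) * \<phi> y \<partial>Qs k) - (\<integral>y. f (x, y) * \<phi> y \<partial>Qs k)) \<longlonglongrightarrow> 0"
  proof (rule tendstoI)
    fix e :: real assume e: "e > 0"
    \<comment> \<open>The added 1 keeps the denominator positive when \<open>C = 0\<close> and makes
      the final error \<open>2 * C * d\<close> strictly less than \<open>e\<close>.\<close>
    define d where "d = e / (2 * C + 1)"
    have d: "d > 0" using e C by (simp add: d_def)
    have "2 * C * d < (2 * C + 1) * d" using d by (simp add: distrib_right)
    also have "\<dots> = e" using C by (simp add: d_def)
    finally have Cd: "2 * C * d < e" .
    have "\<forall>\<^sub>F k in sequentially. \<forall>z\<in>?Z \<times> K. dist (fs k z) (f z) < d"
      using unif[OF Z] d by (auto simp: uniform_limit_iff)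
    moreover have "uniformly_continuous_on (?Z \<times> K) f"
      by (rule compact_uniformly_continuous[OF continuous_on_subset[OF f_cont] Z]) simp
    then obtain r where r: "r > 0"
        "\<And>z z'. z \<in> ?Z \<times> K \<Longrightarrow> z' \<in> ?Z \<times> K \<Longrightarrow> dist z' z < r \<Longrightarrow> dist (f z') (f z) < d"
      using d unfolding uniformly_continuous_on_def by metis
    have "\<forall>\<^sub>F k in sequentially. dist (xs k) x < r" using x r(1) by (rule tendstoD)
    ultimately show "\<forall>\<^sub>F k in sequentially.
        dist ((\<integral>y. fs k (xs k, y) * \<phi> y \<partial>Qs k) - (\<integral>y. f (x, y) * \<phi> y \<partial>Qs k)) 0 < e"
    proof eventually_elim
      case (elim k)
      interpret prob_space "Qs k" using Qs by (simp add: prob_borel_def)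
      have le: "\<bar>fs k (xs k, y) * \<phi> y - f (x, y) * \<phi> y\<bar> \<le> 2 * C * d" for y
      proof (cases "y \<in> K")
        case True
        \<comment> \<open>One \<open>d\<close> pays for replacing \<open>fs k\<close> by
          \<open>f\<close> at the moving point, the other for moving from \<open>xs k\<close> to
          \<open>x\<close> by uniform continuity of \<open>f\<close>.\<close>
        have "dist (fs k (xs k, y)) (f (xs k, y)) < d" using elim(1) True by auto
        moreover have "dist (f (xs k, y)) (f (x, y)) < d"
          by (rule r(2)) (use True elim(2) in \<open>auto simp: dist_Pair_Pair\<close>)
        ultimately have "\<bar>fs k (xs k, y) - f (x, y)\<bar> \<le> 2 * d" by (simp add: dist_real_def)
        then have "\<bar>fs k (xs k, y) - f (x, y)\<bar> * \<bar>\<phi> y\<bar> \<le> 2 * d * C"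
          using \<phi>(2)[of y] d by (intro mult_mono) auto
        then show ?thesis unfolding left_diff_distrib[symmetric] abs_mult by (simp only: mult_ac)
      qed (use K(2) C d in simp)
      have "\<bar>\<integral>y. fs k (xs k, y) * \<phi> y - f (x, y) * \<phi> y \<partial>Qs k\<bar> \<le>
          (\<integral>y. \<bar>fs k (xs k, y) * \<phi> y - f (x, y) * \<phi> y\<bar> \<partial>Qs k)"
        by (rule integral_abs_bound)
      also have "\<dots> \<le> (\<integral>y. 2 * C * d \<partial>Qs k)"
        by (rule integral_mono) (use int int' le in auto)
      also have "\<dots> = 2 * C * d" by (rule prob_borel_integral_const[OF Qs])
      finally show ?case
        unfolding dist_real_def diff_0_right Bochner_Integration.integral_diff[OF int int', symmetric]
        using Cd by linarith
    qed
  qed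
  from tendsto_add[OF this conv] show ?thesis unfolding diff_add_cancel add_0 .
qed

text \<open>The total mass of the limit being one upgrades vague to weak convergence.\<close>
lemma locally_uniform_density_weak:
  fixes Q :: "'b::polish_space measure" and f :: "'a::polish_space \<times> 'b \<Rightarrow> real"
  assumes loc_compact: "locally_compact_space (euclidean :: 'b topology)"
    and Qs: "\<And>k. Qs k \<in> prob_borel" and Q: "Q \<in> prob_borel" and Qconv: "weak_star_conv Qs Q"
    and fs_m: "\<And>k. fs k \<in> borel_measurable borel" and fs0: "\<And>k z. 0 \<le> fs k z"
    and f_cont: "continuous_on UNIV f" and f0: "\<And>z. 0 \<le> f z"
    and unif: "\<And>K. compact K \<Longrightarrow> uniform_limit K fs f sequentially"
    and x: "xs \<longlonglongrightarrow> x"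
    and \<nu>s: "\<And>k. density (Qs k) (\<lambda>y. ennreal (fs k (xs k, y))) \<in> prob_borel"
    and \<nu>: "density Q (\<lambda>y. ennreal (f (x, y))) \<in> prob_borel" and g: "g \<in> bcont"
  shows "(\<lambda>k. \<integral>y. g y \<partial>density (Qs k) (\<lambda>y. ennreal (fs k (xs k, y))))
    \<longlonglongrightarrow> (\<integral>y. g y \<partial>density Q (\<lambda>y. ennreal (f (x, y))))"
proof (rule weak_conv_lower_approx[OF \<nu>s \<nu> _ g])
  fix h :: "'b \<Rightarrow> real" assume h: "h \<in> bcont" and h0: "\<And>y. 0 \<le> h y"
  obtain \<theta> :: "nat \<Rightarrow> 'b \<Rightarrow> real" and K where \<theta>: "\<And>k. continuous_on UNIV (\<theta> k)" "\<And>k y. 0 \<le> \<theta> k y"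
    "\<And>k y. \<theta> k y \<le> 1" "\<And>k. compact (K k)" "\<And>k y. y \<notin> K k \<Longrightarrow> \<theta> k y = 0" "\<And>y. (\<lambda>k. \<theta> k y) \<longlonglongrightarrow> 1"
    using compact_cutoffs[OF loc_compact] by metis
  obtain C where C: "\<And>y. \<bar>h y\<bar> \<le> C" using bcont_bounded[OF h] by metis
  have hc: "continuous_on UNIV h" using h by (simp add: bcont_def)
  \<comment> \<open>Continuous minorants of \<open>h\<close>, each vanishing off a compact set, with
    pointwise limit \<open>h\<close>.\<close>
  define \<phi> where "\<phi> j y = h y * \<theta> j y" for j y
  have \<phi>: "continuous_on UNIV (\<phi> j)" for j
    unfolding \<phi>_def by (intro continuous_intros hc \<theta>(1))
  then have \<phi>m: "\<phi> j \<in> borel_measurable borel" for j by (rule borel_measurable_continuous_onI)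
  have \<phi>0: "0 \<le> \<phi> j y" "\<phi> j y \<le> h y" for j y
    unfolding \<phi>_def using h0[of y] \<theta>(2,3)[of j y] by (auto simp: mult_left_le)
  have \<phi>C: "\<bar>\<phi> j y\<bar> \<le> C" for j y using \<phi>0[of j y] C[of y] by linarith
  have S: "\<And>k. sets (Qs k) = sets borel" "sets Q = sets borel" using Qs Q by (auto simp: prob_borel_def)
  have I: "(\<integral>y. \<phi> j y \<partial>density M (\<lambda>y. ennreal (u (z, y)))) = (\<integral>y. u (z, y) * \<phi> j y \<partial>M)"
    if "sets M = sets borel" "u \<in> borel_measurable borel" "\<And>z. 0 \<le> u z"
    for M and u :: "'a \<times> 'b \<Rightarrow> real" and z j
    using borel_measurable_section[OF that(2)] \<phi>m that
    by (subst integral_density) (auto cong: measurable_cong_sets[OF that(1) refl])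
  have conv: "(\<lambda>k. \<integral>y. \<phi> j y \<partial>density (Qs k) (\<lambda>y. ennreal (fs k (xs k, y))))
    \<longlonglongrightarrow> (\<integral>y. \<phi> j y \<partial>density Q (\<lambda>y. ennreal (f (x, y))))" for j
    unfolding I[OF S(1) fs_m fs0] I[OF S(2) borel_measurable_continuous_onI[OF f_cont] f0]
  proof (rule locally_uniform_density_vague[OF Qs Qconv f_cont unif x \<phi> \<phi>C \<theta>(4)[of j]])
    show "\<phi> j y = 0" if "y \<notin> K j" for y using \<theta>(5)[OF that] by (simp add: \<phi>_def)
    fix k
    \<comment> \<open>Although \<open>fs k\<close> may be unbounded, the density defines a
      probability measure, under which the bounded function \<open>\<phi> j\<close> is
      integrable.\<close>
    have "integrable (density (Qs k) (\<lambda>y. ennreal (fs k (xs k, y)))) (\<phi> j)"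
      by (rule prob_borel_integrable[OF \<nu>s \<phi>m \<phi>C])
    then show "integrable (Qs k) (\<lambda>y. fs k (xs k, y) * \<phi> j y)"
      using borel_measurable_section[OF fs_m] \<phi>m fs0
      by (subst (asm) integrable_density) (auto cong: measurable_cong_sets[OF S(1) refl])
  qed auto
  have lim: "(\<lambda>j. \<phi> j y) \<longlonglongrightarrow> h y" for y
    using tendsto_mult_left[OF \<theta>(6)[of y], of "h y"] by (simp add: \<phi>_def)
  show "\<exists>\<phi>. \<forall>j. \<phi> j \<in> borel_measurable borel \<and> (\<forall>y. 0 \<le> \<phi> j y \<and> \<phi> j y \<le> h y) \<and>
      (\<forall>y. (\<lambda>j. \<phi> j y) \<longlonglongrightarrow> h y) \<and>
      (\<lambda>k. \<integral>y. \<phi> j y \<partial>density (Qs k) (\<lambda>y. ennreal (fs k (xs k, y))))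
        \<longlonglongrightarrow> (\<integral>y. \<phi> j y \<partial>density Q (\<lambda>y. ennreal (f (x, y))))"
    by (intro exI[of _ \<phi>] allI conjI \<phi>m \<phi>0 conv lim)
qed

section \<open>Convergence in the topology of information\<close>

theorem theorem2:
  fixes \<mu>s :: "nat \<Rightarrow> ('a::polish_space \<times> 'b::polish_space) measure"
    and \<mu> :: "('a \<times> 'b) measure"
    and fs :: "nat \<Rightarrow> 'a \<times> 'b \<Rightarrow> real"
    and f :: "'a \<times> 'b \<Rightarrow> real"
  assumes loc_compact: "locally_compact_space (euclidean :: 'b topology)"
    and prob_n: "\<And>n. \<mu>s n \<in> prob_borel"
    and prob: "\<mu> \<in> prob_borel"
    and fs_meas: "\<And>n. fs n \<in> borel_measurable borel"
    and fs_nonneg: "\<And>n z. fs n z \<ge> 0"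
    and fs_dens: "\<And>n. \<mu>s n = density (marg1 (\<mu>s n) \<Otimes>\<^sub>M marg2 (\<mu>s n)) (\<lambda>z. ennreal (fs n z))"
    and weak: "weak_star_conv \<mu>s \<mu>"
    and f_cont: "continuous_on UNIV f"
    and f_nonneg: "\<And>z. f z \<ge> 0"
    and f_dens: "\<mu> = density (marg1 \<mu> \<Otimes>\<^sub>M marg2 \<mu>) (\<lambda>z. ennreal (f z))"
    and unif: "\<And>K. compact K \<Longrightarrow> uniform_limit K fs f sequentially"
  shows "info_conv \<mu>s \<mu>"
proof -
  \<comment> \<open>The good points, where the chosen conditional distribution is exactly the one
    given by the density. They have full marginal measure, and the mapping theorem examines only
    sequences through them with a good limit point.\<close>
  define Ds where "Ds \<kappa>s = (\<lambda>n. {x. \<kappa>s n x = density (marg2 (\<mu>s n)) (\<lambda>y. ennreal (fs n (x, y)))})"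
    for \<kappa>s :: "nat \<Rightarrow> 'a \<Rightarrow> 'b measure"
  define D where "D \<kappa> = {x. \<kappa> x = density (marg2 \<mu>) (\<lambda>y. ennreal (f (x, y)))}"
    for \<kappa> :: "'a \<Rightarrow> 'b measure"
  show ?thesis
    unfolding info_conv_def psi_integral_def
  proof (intro allI impI ballI, elim conjE)
    fix \<kappa>s \<kappa> and G :: "'a \<times> 'b measure \<Rightarrow> real"
    assume \<kappa>s: "\<forall>n. rcd (\<mu>s n) (\<kappa>s n)" and \<kappa>: "rcd \<mu> \<kappa>" and G: "G \<in> bcont_psi"
    have \<kappa>p: "\<And>n x. \<kappa>s n x \<in> prob_borel" "\<And>x. \<kappa> x \<in> prob_borel"
      using \<kappa>s \<kappa> by (auto simp: rcd_def)
    obtain C where C: "\<And>x \<nu>. \<nu> \<in> prob_borel \<Longrightarrow> \<bar>G (x, \<nu>)\<bar> \<le> C"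
      using bcont_psi_bounded[OF G] by metis
    note Q = marg_prob_borel(2)[OF prob_n] marg_prob_borel(2)[OF prob]
    show "(\<lambda>n. \<integral>x. G (x, \<kappa>s n x) \<partial>marg1 (\<mu>s n)) \<longlonglongrightarrow> (\<integral>x. G (x, \<kappa> x) \<partial>marg1 \<mu>)"
    proof (rule extended_continuous_mapping[where Ds="Ds \<kappa>s" and D="D \<kappa>" and C=C])
      show "(\<lambda>x. G (x, \<kappa>s n x)) \<in> borel_measurable borel" for n
        by (rule kernel_measurable[OF \<kappa>p(1) _ G]) (use \<kappa>s in \<open>auto simp: rcd_def\<close>)
      show "(\<lambda>x. G (x, \<kappa> x)) \<in> borel_measurable borel"
        by (rule kernel_measurable[OF \<kappa>p(2) _ G]) (use \<kappa> in \<open>auto simp: rcd_def\<close>)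
      show "AE x in marg1 (\<mu>s n). x \<in> Ds \<kappa>s n" for n
        using rcd_eq_density[OF prob_n[of n] fs_meas[of n] fs_dens[of n]] \<kappa>s by (simp add: Ds_def)
      show "AE x in marg1 \<mu>. x \<in> D \<kappa>"
        using rcd_eq_density[OF prob borel_measurable_continuous_onI[OF f_cont] f_dens \<kappa>]
        by (simp add: D_def)
      show "weak_star_conv (\<lambda>n. marg1 (\<mu>s n)) (marg1 \<mu>)"
        by (rule marg_weak_star_conv(1)[OF prob_n prob weak])
      show "marg1 (\<mu>s n) \<in> prob_borel" for n by (rule marg_prob_borel(1)[OF prob_n])
      show "marg1 \<mu> \<in> prob_borel" by (rule marg_prob_borel(1)[OF prob])
      show "\<bar>G (x, \<kappa>s n x)\<bar> \<le> C" "\<bar>G (x, \<kappa> x)\<bar> \<le> C" for n x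
        using C \<kappa>p by blast+
      fix m y x
      assume m: "filterlim m at_top sequentially" and y: "y \<longlonglongrightarrow> x" and x: "x \<in> D \<kappa>"
        and yD: "\<And>k. y k \<in> Ds \<kappa>s (m k)"
      have eq: "\<kappa>s (m k) (y k) = density (marg2 (\<mu>s (m k))) (\<lambda>t. ennreal (fs (m k) (y k, t)))" for k
        using yD[of k] by (simp add: Ds_def)
      have eq': "\<kappa> x = density (marg2 \<mu>) (\<lambda>t. ennreal (f (x, t)))"
        using x by (simp add: D_def)
      have eq_p: "density (marg2 (\<mu>s (m k))) (\<lambda>t. ennreal (fs (m k) (y k, t))) \<in> prob_borel" for k
        using \<kappa>p(1)[of "m k" "y k"] unfolding eq .
      \<comment> \<open>The index sequence \<open>m\<close> tends to infinity, possibly with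
        repetitions and out of order; composing limits with it preserves the convergence of the
        second marginals and, below, of the densities.\<close>
      have Qm: "weak_star_conv (\<lambda>k. marg2 (\<mu>s (m k))) (marg2 \<mu>)"
        unfolding weak_star_conv_def
      proof
        fix g :: "'b \<Rightarrow> real" assume "g \<in> bcont"
        then have "(\<lambda>n. \<integral>z. g z \<partial>marg2 (\<mu>s n)) \<longlonglongrightarrow> (\<integral>z. g z \<partial>marg2 \<mu>)"
          using marg_weak_star_conv(2)[OF prob_n prob weak] by (simp add: weak_star_conv_def)
        from filterlim_compose[OF this m]
        show "(\<lambda>k. \<integral>z. g z \<partial>marg2 (\<mu>s (m k))) \<longlonglongrightarrow> (\<integral>z. g z \<partial>marg2 \<mu>)" .
      qed
      have um: "uniform_limit K (\<lambda>k. fs (m k)) f sequentially" if "compact K" for K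
        using filterlim_compose[OF unif[OF that] m] .
      have "(\<lambda>k. \<integral>t. g t \<partial>\<kappa>s (m k) (y k)) \<longlonglongrightarrow> (\<integral>t. g t \<partial>\<kappa> x)" if "g \<in> bcont" for g
        unfolding eq eq'
        by (rule locally_uniform_density_weak[where fs="\<lambda>k. fs (m k)" and xs=y, OF loc_compact])
          (fact Q Qm fs_meas fs_nonneg f_cont f_nonneg um y eq_p \<kappa>p(2)[of x, unfolded eq'] that)+
      from bcont_psi_tendsto[where \<nu>s="\<lambda>k. \<kappa>s (m k) (y k)", OF G y \<kappa>p(1) \<kappa>p(2) this]
      show "(\<lambda>k. G (y k, \<kappa>s (m k) (y k))) \<longlonglongrightarrow> G (x, \<kappa> x)" .
    qed
  qed
qed

end
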